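(* Let $V>0$ and $1\le p<\infty$, and let the data be generated by the uncoupled isotonic regression model (described in the context) with $n$ observations, regression function $f\in\mathcal{F}_V$, and noise distribution $\mathcal{D}=N(0,1)$. There exists a universal constant $C'>0$ (independent of $n$, $V$, $p$) such that $$\inf_{g_n}\sup_{f\in\mathcal{F}_V}\mathbb{E}\|f-g_n\|_p\ge C'\,V\,\frac{\log\log n}{\log n}\,\big(1+o_V(1)\big),$$ where the infimum is taken over all measurable functions $g_n$ of the data and $o_V(1)$ denotes a quantity depending on $V$ (and $n$) that goes to $0$ as $n\to\infty$.
   Context: Uncoupled isotonic regression model: $x_1<\dots<x_n$ are fixed deterministic distinct design points in $[0,1]$, and $y_i=f(x_i)+\xi_i$ for $1\le i\le n$, where $\xi_1,\dots,\xi_n$ are i.i.d. from $\mathcal{D}$. One observes only the unordered sets (multisets) $\{x_1,\dots,x_n\}$ and $\{y_1,\dots,y_n\}$, i.e. the pairing between the $x$'s and $y$'s is not observed; $V$ and $\mathcal{D}$ are known. $\mathcal{F}_V$ is the class of nondecreasing functions $f:[0,1]\to\mathbb{R}$ with $|f(x)|\le V$ for all $x\in[0,1]$. The norm is empirical: for $g:[0,1]\to\mathbb{R}$, $\|g\|_p^p:=\frac1n\sum_{i=1}^n|g(x_i)|^p$. An estimator $g_n$ is a (data-dependent) function from $[0,1]$ to $\mathbb{R}$. $\log$ is the natural logarithm. *)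

theory Defs
  imports "HOL-Probability.Probability"
begin

text \<open>Design points: \<open>x 1 < \<dots> < x n\<close> in \<open>[0,1]\<close>.\<close>

definition is_design :: "nat \<Rightarrow> (nat \<Rightarrow> real) \<Rightarrow> bool" where
  "is_design n x \<longleftrightarrow> strict_mono_on {1..n} x \<and> x ` {1..n} \<subseteq> {0..1}"

text \<open>Functions on \<open>[0,1]\<close> are total functions on the reals whose values outside \<open>[0,1]\<close>
  never matter.\<close>

definition monotone_class :: "real \<Rightarrow> (real \<Rightarrow> real) set" where
  "monotone_class V = {f. mono_on {0..1} f \<and> (\<forall>t\<in>{0..1}. \<bar>f t\<bar> \<le> V)}"

definition empirical_norm :: "nat \<Rightarrow> (nat \<Rightarrow> real) \<Rightarrow> real \<Rightarrow> (real \<Rightarrow> real) \<Rightarrow> real" where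
  "empirical_norm n x p g = ((1 / real n) * (\<Sum>i=1..n. \<bar>g (x i)\<bar> powr p)) powr (1 / p)"

text \<open>What the statistician observes: the set of design points and the multiset of responses,
  without the pairing.\<close>

definition uncoupled_data ::
    "nat \<Rightarrow> (nat \<Rightarrow> real) \<Rightarrow> (nat \<Rightarrow> real) \<Rightarrow> real set \<times> real multiset" where
  "uncoupled_data n x y = (x ` {1..n}, image_mset y (mset_set {1..n}))"

text \<open>An estimator maps the data to a function on \<open>[0,1]\<close>. Multisets of responses carry the
  quotient sigma-algebra of the Borel sigma-algebra on response vectors (so measurability of a
  function of the multiset means Borel measurability of its composition with the map from
  response vectors to multisets), and functions on \<open>[0,1]\<close> carry the product (evaluation)
  sigma-algebra. The design is deterministic, so no measurability in it is required.\<close>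

definition estimators ::
    "nat \<Rightarrow> (nat \<Rightarrow> real) \<Rightarrow> (real set \<times> real multiset \<Rightarrow> real \<Rightarrow> real) set" where
  "estimators n x =
     {g. \<forall>t\<in>{0..1}. (\<lambda>y. g (uncoupled_data n x y) t) \<in> borel_measurable (\<Pi>\<^sub>M i\<in>{1..n}. borel)}"

definition noise :: "real measure \<Rightarrow> nat \<Rightarrow> (nat \<Rightarrow> real) measure" where
  "noise D n = (\<Pi>\<^sub>M i\<in>{1..n}. D)"

definition risk ::
    "real measure \<Rightarrow> nat \<Rightarrow> (nat \<Rightarrow> real) \<Rightarrow> real \<Rightarrow>
     (real set \<times> real multiset \<Rightarrow> real \<Rightarrow> real) \<Rightarrow> (real \<Rightarrow> real) \<Rightarrow> ennreal" where
  "risk D n x p g f =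
     (\<integral>\<^sup>+ \<xi>. ennreal (empirical_norm n x p
        (\<lambda>t. f t - g (uncoupled_data n x (\<lambda>i. f (x i) + \<xi> i)) t)) \<partial>noise D n)"

definition minimax_risk ::
    "real measure \<Rightarrow> nat \<Rightarrow> (nat \<Rightarrow> real) \<Rightarrow> real \<Rightarrow> real \<Rightarrow> ennreal" where
  "minimax_risk D n x V p = (INF g\<in>estimators n x. SUP f\<in>monotone_class V. risk D n x p g f)"

definition std_gaussian :: "real measure" where
  "std_gaussian = density lborel (\<lambda>t. ennreal (std_normal_density t))"

end

theory Submission
  imports Defs "HOL-Real_Asymp.Real_Asymp"
begin

text \<open>
  Without the pairing, the data reveal the regression function only through the multiset
  of its values at the design points, blurred by Gaussian noise. Recovering \<open>f\<close> is thus a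
  deconvolution problem, and Gaussian deconvolution is hard because distributions with
  many common moments become almost indistinguishable after smoothing.

  To exploit this, take two sets of \<open>N\<close> nodes in \<open>[-V, V]\<close>, namely \<open>V * cos a\<close> for \<open>a\<close> an
  even, respectively odd, multiple of \<open>pi / N\<close>, counted around the full circle. The
  uniform distributions on them have equal moments of all orders below \<open>N\<close>
  (\<open>cosine_node_moments\<close>), yet an odd node has average distance at least \<open>V / (2 * N)\<close>
  from the even ones (\<open>sum_infdist_odd_nodes_ge\<close>). After adding standard Gaussian noise,
  the two distributions differ by no more than about \<open>N powr (- N / 4)\<close>, up to a factor
  exponential in \<open>N\<close> (\<open>gaussian_smoothing_close\<close>): the likelihood ratio \<open>exp (y * u -
  u\<^sup>2 / 2)\<close> is close to a polynomial in \<open>u\<close> of degree below \<open>N\<close>, which the matching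
  moments cancel.

  Now draw \<open>n\<close> independent values from one of the two distributions and let \<open>f\<close> take them
  in increasing order along the design. The order of the values is invisible in the
  multiset of responses, so the observation behaves like an independent sample from the
  smoothed distribution. Replacing the coordinates one at a time (\<open>sum_PiE_hybrid\<close>) loses
  a factor \<open>n\<close>. If \<open>n\<close> times the one-observation error is small, no estimator tells the
  two cases apart, although the mean distance of the values of \<open>f\<close> to the even nodes, a
  functional that is 1-Lipschitz in the empirical \<open>L\<^sup>1\<close> norm, vanishes in one case
  and averages at least \<open>V / (2 * N)\<close> in the other. Hence the risk is at least a constant
  times \<open>V / N\<close> (\<open>minimax_risk_ge\<close>).

  It remains to choose \<open>N\<close> as small as possible such that \<open>N powr (- N / 4)\<close> beats \<open>1 /
  n\<close>: this needs \<open>N\<close> of order \<open>ln n / ln (ln n)\<close> (\<open>eventually_node_count\<close>). For fixed \<open>V\<close>,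
  the exponential factors are negligible once \<open>n\<close> is large.
\<close>

section \<open>Two interlacing node sets with matching moments\<close>

text \<open>
  Multiplying by \<open>2 * sin (d * pi / N)\<close> turns each summand into a difference of two
  consecutive sines, and the telescoped sum covers \<open>d\<close> whole periods. The bound on \<open>d\<close> keeps
  this factor away from zero.
\<close>

lemma sum_cos_equally_spaced_eq_0:
  fixes d :: int and N :: nat and \<alpha> :: real
  assumes "d \<noteq> 0" "\<bar>d\<bar> < int N"
  shows "(\<Sum>i<N. cos (of_int d * (2 * pi * real i / real N + \<alpha>))) = 0"
proof -
  have N: "real N > 0" using assms by auto
  define s where "s = of_int d * pi / real N"
  define F where "F = (\<lambda>i::nat. sin (of_int d * \<alpha> + (2 * real i - 1) * s))"
  have step: "2 * sin s * cos (of_int d * (2 * pi * real i / real N + \<alpha>)) = F (Suc i) - F i" for i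
  proof -
    have "of_int d * (2 * pi * real i / real N + \<alpha>) = of_int d * \<alpha> + 2 * real i * s"
      by (simp add: s_def algebra_simps)
    moreover have "F (Suc i) = sin ((of_int d * \<alpha> + 2 * real i * s) + s)"
      and "F i = sin ((of_int d * \<alpha> + 2 * real i * s) - s)"
      by (simp_all add: F_def algebra_simps)
    ultimately show ?thesis by (simp add: sin_add sin_diff)
  qed
  have "F N = sin ((of_int d * \<alpha> - s) + 2 * pi * of_int d)"
    using N by (simp add: F_def s_def field_simps)
  also have "\<dots> = F 0"
    by (simp only: F_def sin_add sin_integer_2pi cos_integer_2pi Ints_of_int) (simp add: sin_diff)
  finally have FN: "F N = F 0" .
  have "2 * sin s * (\<Sum>i<N. cos (of_int d * (2 * pi * real i / real N + \<alpha>)))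
      = (\<Sum>i<N. F (Suc i) - F i)"
    by (simp add: sum_distrib_left step)
  also have "\<dots> = 0" by (simp add: sum_lessThan_telescope FN)
  finally have "sin s = 0 \<or> (\<Sum>i<N. cos (of_int d * (2 * pi * real i / real N + \<alpha>))) = 0"
    by simp
  moreover have "sin s \<noteq> 0"
  proof
    assume "sin s = 0"
    then obtain m :: int where "s = of_int m * pi" by (auto simp: sin_zero_iff_int2)
    then have "real_of_int d = of_int (m * int N)" using N by (simp add: s_def field_simps)
    then have "d = m * int N" by linarith
    with assms show False
      by (metis abs_mult abs_of_nat dvd_imp_le_int dvd_triv_right not_less)
  qed
  ultimately show ?thesis by simp
qed

text \<open>
  A cosine power is a trigonometric polynomial, and its nonconstant harmonics cancel over a
  full turn as long as their frequencies stay below \<open>N\<close>. The additional factor of frequency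
  \<open>d\<close> makes this provable by induction: each power of the cosine is traded for the
  frequencies \<open>d + 1\<close> and \<open>d - 1\<close>.
\<close>

lemma sum_cos_power_times_cos_shift:
  fixes d :: int and N :: nat
  assumes "\<bar>d\<bar> + int k < int N"
  shows "(\<Sum>i<N. cos (2 * pi * real i / real N + \<alpha>) ^ k
            * cos (of_int d * (2 * pi * real i / real N + \<alpha>)))
       = (\<Sum>i<N. cos (2 * pi * real i / real N + \<beta>) ^ k
            * cos (of_int d * (2 * pi * real i / real N + \<beta>)))"
  using assms
proof (induction k arbitrary: d)
  case 0
  then show ?case
    by (cases "d = 0") (simp_all add: sum_cos_equally_spaced_eq_0)
next
  case (Suc k)
  have product: "cos t ^ Suc k * cos (of_int d * t)
      = (cos t ^ k * cos (of_int (d + 1) * t) + cos t ^ k * cos (of_int (d - 1) * t)) / 2" for t :: real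
    by (simp add: distrib_right left_diff_distrib cos_add cos_diff algebra_simps)
  show ?case
    unfolding product sum_divide_distrib[symmetric] sum.distrib
    using Suc.IH[of "d + 1"] Suc.IH[of "d - 1"] Suc.prems by auto
qed

lemma sum_cos_power_shift:
  assumes "k < N"
  shows "(\<Sum>i<N. cos (2 * pi * real i / real N + \<alpha>) ^ k)
       = (\<Sum>i<N. cos (2 * pi * real i / real N + \<beta>) ^ k)"
  using sum_cos_power_times_cos_shift[of 0 k N \<alpha> \<beta>] assms by simp

lemma abs_sin_of_nat_mult_le: "\<bar>sin (real n * x)\<bar> \<le> real n * \<bar>sin x\<bar>"
proof (induction n)
  case (Suc n)
  have "\<bar>sin (real (Suc n) * x)\<bar> = \<bar>sin (real n * x) * cos x + cos (real n * x) * sin x\<bar>"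
    by (simp add: distrib_right sin_add algebra_simps)
  also have "\<dots> \<le> \<bar>sin (real n * x)\<bar> * \<bar>cos x\<bar> + \<bar>cos (real n * x)\<bar> * \<bar>sin x\<bar>"
    by (metis abs_mult abs_triangle_ineq)
  also have "\<dots> \<le> \<bar>sin (real n * x)\<bar> * 1 + 1 * \<bar>sin x\<bar>"
    by (intro add_mono mult_mono) auto
  finally show ?case using Suc by (simp add: distrib_right)
qed simp

text \<open>
  At \<open>N\<close> times this angle the sine is \<open>1\<close> or \<open>-1\<close>, while multiplying an angle by \<open>N\<close>
  enlarges the absolute value of the sine by a factor of at most \<open>N\<close>.
\<close>

lemma abs_sin_odd_multiple_ge:
  fixes m :: int
  assumes "N > 0"
  shows "1 / real N \<le> \<bar>sin (of_int (2 * m + 1) * pi / (2 * real N))\<bar>"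
proof -
  have "real N * (of_int (2 * m + 1) * pi / (2 * real N)) = of_int m * pi + pi / 2"
    using assms by (simp add: field_simps)
  then have "\<bar>sin (real N * (of_int (2 * m + 1) * pi / (2 * real N)))\<bar> = 1"
    by (simp add: sin_add sin_zero_abs_cos_one sin_npi_int mult.commute)
  then show ?thesis
    using abs_sin_of_nat_mult_le[of N "of_int (2 * m + 1) * pi / (2 * real N)"] assms
    by (simp add: field_simps)
qed

text \<open>
  The difference is \<open>2 * sin p * sin q\<close> with \<open>p\<close> and \<open>q\<close> odd multiples of \<open>pi / (2 * N)\<close>, so
  both sines have absolute value at least \<open>1 / N\<close>. Moreover \<open>a = p - q\<close>, so the two absolute
  values add up to at least \<open>\<bar>sin a\<bar>\<close>. Nodes near the ends of the interval are
  closer together than those in the middle, which is why the bound has the factor \<open>\<bar>sin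
  a\<bar>\<close>.
\<close>

lemma abs_cos_diff_odd_even_ge:
  fixes i l :: int
  assumes "N > 0"
  defines "a \<equiv> of_int (2 * i + 1) * pi / real N" and "b \<equiv> of_int (2 * l) * pi / real N"
  shows "\<bar>sin a\<bar> / real N \<le> \<bar>cos a - cos b\<bar>"
proof -
  define p q where "p = (a + b) / 2" and "q = (b - a) / 2"
  have "p = of_int (2 * (i + l) + 1) * pi / (2 * real N)"
    "q = of_int (2 * (l - i - 1) + 1) * pi / (2 * real N)"
    using assms(1) by (simp_all add: p_def q_def a_def b_def field_simps)
  then have p: "1 / real N \<le> \<bar>sin p\<bar>" and q: "1 / real N \<le> \<bar>sin q\<bar>"
    using abs_sin_odd_multiple_ge[OF assms(1)] by metis+
  have "\<bar>sin a\<bar> = \<bar>sin p * cos q - cos p * sin q\<bar>"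
  proof -
    have "a = p - q" by (simp add: p_def q_def field_simps)
    then show ?thesis by (simp add: sin_diff)
  qed
  also have "\<dots> \<le> \<bar>sin p\<bar> * \<bar>cos q\<bar> + \<bar>cos p\<bar> * \<bar>sin q\<bar>"
    by (metis abs_mult abs_triangle_ineq4)
  also have "\<dots> \<le> \<bar>sin p\<bar> * 1 + 1 * \<bar>sin q\<bar>"
    by (intro add_mono mult_mono) auto
  finally have "\<bar>sin a\<bar> / real N \<le> \<bar>sin p\<bar> * (1 / real N) + (1 / real N) * \<bar>sin q\<bar>"
    using assms(1) by (simp add: field_simps)
  also have "\<dots> \<le> \<bar>sin p\<bar> * \<bar>sin q\<bar> + \<bar>sin p\<bar> * \<bar>sin q\<bar>"
    using p q by (intro add_mono mult_mono) auto
  also have "\<dots> = \<bar>cos a - cos b\<bar>"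
    by (simp add: cos_diff_cos p_def q_def abs_mult)
  finally show ?thesis .
qed

text \<open>
  As \<open>i\<close> runs through \<open>0, \<dots>, N - 1\<close>, these are the projections of \<open>N\<close> equally spaced
  points on a circle of radius \<open>V\<close>. The phases used below are \<open>0\<close> and \<open>pi / N\<close>: the angles
  are then the even and the odd multiples of \<open>pi / N\<close>.
\<close>

definition cosine_node :: "real \<Rightarrow> nat \<Rightarrow> real \<Rightarrow> nat \<Rightarrow> real" where
  "cosine_node V N \<alpha> i = V * cos (2 * pi * real i / real N + \<alpha>)"

lemma abs_cosine_node_le: "V \<ge> 0 \<Longrightarrow> \<bar>cosine_node V N \<alpha> i\<bar> \<le> V"
  by (simp add: cosine_node_def abs_mult mult_left_le)

text \<open>
  For the phases \<open>0\<close> and \<open>pi / N\<close> this is the alternating quadrature rule at the extrema of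
  the Chebyshev polynomial of degree \<open>N\<close>: uniform averages over the even and over the odd
  nodes agree on all polynomials of smaller degree.
\<close>

lemma cosine_node_moments:
  assumes "k < N"
  shows "(\<Sum>i<N. cosine_node V N \<alpha> i ^ k) = (\<Sum>i<N. cosine_node V N \<beta> i ^ k)"
  using sum_cos_power_shift[OF assms, of \<alpha> \<beta>]
  by (simp add: cosine_node_def power_mult_distrib sum_distrib_left[symmetric])

definition even_nodes :: "real \<Rightarrow> nat \<Rightarrow> real set" where
  "even_nodes V N = cosine_node V N 0 ` {..<N}"

text \<open>
  Consecutive angles differ by \<open>pi / N\<close>, and the cosine is 1-Lipschitz.
\<close>

lemma infdist_odd_node_le:
  assumes "V \<ge> 0" "i < N"
  shows "infdist (cosine_node V N (pi / N) i) (even_nodes V N) \<le> V * pi / N"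
proof -
  define a b where "a = 2 * pi * real i / real N + pi / real N" and "b = 2 * pi * real i / real N"
  have "\<bar>cos a - cos b\<bar> = 2 * \<bar>sin ((a + b) / 2)\<bar> * \<bar>sin ((b - a) / 2)\<bar>"
    by (simp add: cos_diff_cos abs_mult)
  also have "\<dots> \<le> 2 * 1 * \<bar>(b - a) / 2\<bar>"
    by (intro mult_mono abs_sin_x_le_abs_x) auto
  also have "\<dots> = pi / N" by (simp add: a_def b_def)
  finally have "V * \<bar>cos a - cos b\<bar> \<le> V * (pi / N)" using assms by (intro mult_left_mono)
  then have "dist (cosine_node V N (pi / N) i) (cosine_node V N 0 i) \<le> V * pi / N"
    using assms
    by (simp add: cosine_node_def dist_real_def a_def b_def right_diff_distrib[symmetric] abs_mult)
  then show ?thesis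
    by (rule infdist_le2[rotated]) (use assms in \<open>auto simp: even_nodes_def\<close>)
qed

lemma infdist_odd_node_ge:
  assumes "V \<ge> 0" "N > 0"
  shows "V * \<bar>sin (2 * pi * real i / real N + pi / real N)\<bar> / N
           \<le> infdist (cosine_node V N (pi / N) i) (even_nodes V N)"
proof -
  have ne: "even_nodes V N \<noteq> {}" using assms by (auto simp: even_nodes_def)
  have "V * \<bar>sin (2 * pi * real i / real N + pi / real N)\<bar> / N
      \<le> dist (cosine_node V N (pi / N) i) (cosine_node V N 0 l)" for l
  proof -
    have "2 * pi * real i / real N + pi / real N = of_int (2 * int i + 1) * pi / real N"
      "2 * pi * real l / real N = of_int (2 * int l) * pi / real N"
      by (simp_all add: distrib_right add_divide_distrib)
    then have "\<bar>sin (2 * pi * real i / real N + pi / real N)\<bar> / N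
        \<le> \<bar>cos (2 * pi * real i / real N + pi / real N) - cos (2 * pi * real l / real N)\<bar>"
      using abs_cos_diff_odd_even_ge[OF assms(2), of "int i" "int l"] by metis
    then show ?thesis
      using mult_left_mono[OF _ assms(1)]
      by (fastforce simp: cosine_node_def dist_real_def right_diff_distrib[symmetric] abs_mult
          abs_of_nonneg assms(1))
  qed
  then show ?thesis
    unfolding infdist_notempty[OF ne]
    by (intro cINF_greatest ne) (auto simp: even_nodes_def)
qed

text \<open>
  Although the two node sets have matching moments, they are separated by order \<open>V / N\<close> on
  average: the node at angle \<open>a\<close> contributes at least \<open>V * \<bar>sin a\<bar> / N\<close>, and
  \<open>\<bar>sin a\<bar> \<ge> (sin a)\<^sup>2\<close>, whose mean over the angles is one half.
\<close>

lemma sum_infdist_odd_nodes_ge: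
  assumes "V \<ge> 0" "N > 2"
  shows "V / 2 \<le> (\<Sum>i<N. infdist (cosine_node V N (pi / N) i) (even_nodes V N))"
proof -
  define a where "a = (\<lambda>i. 2 * pi * real i / real N + pi / real N)"
  have "(\<Sum>i<N. cos (2 * a i)) = 0"
    using sum_cos_equally_spaced_eq_0[of 2 N "pi / N"] assms by (simp add: a_def)
  then have "V / 2 = (\<Sum>i<N. V * ((1 - cos (2 * a i)) / 2) / N)"
    using assms
    by (simp add: sum_divide_distrib[symmetric] sum_distrib_left[symmetric] sum_subtractf)
  also have "\<dots> \<le> (\<Sum>i<N. V * \<bar>sin (a i)\<bar> / N)"
  proof (intro sum_mono divide_right_mono mult_left_mono)
    fix i
    have "(1 - cos (2 * a i)) / 2 = \<bar>sin (a i)\<bar> * \<bar>sin (a i)\<bar>"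
      by (simp add: cos_double_sin power2_eq_square)
    also have "\<dots> \<le> \<bar>sin (a i)\<bar> * 1" by (intro mult_left_mono) auto
    finally show "(1 - cos (2 * a i)) / 2 \<le> \<bar>sin (a i)\<bar>" by simp
  qed (use assms in auto)
  also have "\<dots> \<le> (\<Sum>i<N. infdist (cosine_node V N (pi / N) i) (even_nodes V N))"
    unfolding a_def using assms by (intro sum_mono infdist_odd_node_ge) auto
  finally show ?thesis .
qed

section \<open>Gaussian smoothing of moment-matched distributions\<close>

text \<open>
  Compare the tail of the series at \<open>z\<close> with that of the series at \<open>s * \<bar>z\<bar>\<close>: each
  term of order at least \<open>K\<close> gains the factor \<open>1 / s ^ K\<close>. In this form the remainder is
  controlled by a single exponential moment of \<open>z\<close>, and \<open>s\<close> remains free to be optimised.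
\<close>

lemma abs_exp_minus_taylor_le:
  fixes z s :: real
  assumes "s \<ge> 1"
  shows "\<bar>exp z - (\<Sum>k<K. z ^ k / fact k)\<bar> \<le> exp (s * \<bar>z\<bar>) / s ^ K"
proof -
  have series: "(\<lambda>k. x ^ k / fact k) sums exp x" for x :: real
    using exp_converges[of x] by (simp add: divide_inverse_commute)
  define a b where "a = (\<lambda>k. (s * \<bar>z\<bar>) ^ k / fact k)" and "b = (\<lambda>k. z ^ k / fact k)"
  have a: "summable a" "suminf a = exp (s * \<bar>z\<bar>)" and b: "summable b" "suminf b = exp z"
    using series[of "s * \<bar>z\<bar>"] series[of z] by (auto simp: a_def b_def sums_iff)
  have "norm (\<Sum>k. b (k + K)) \<le> (\<Sum>k. a (k + K) / s ^ K)"
  proof (rule norm_suminf_le)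
    show "norm (b (k + K)) \<le> a (k + K) / s ^ K" for k
    proof -
      have "a (k + K) / s ^ K = s ^ k * (\<bar>z\<bar> ^ (k + K) / fact (k + K))"
        using assms by (simp add: a_def power_mult_distrib power_add)
      moreover have "1 * (\<bar>z\<bar> ^ (k + K) / fact (k + K)) \<le> s ^ k * (\<bar>z\<bar> ^ (k + K) / fact (k + K))"
        using assms by (intro mult_right_mono one_le_power) auto
      ultimately show ?thesis by (simp add: b_def power_abs)
    qed
    show "summable (\<lambda>k. a (k + K) / s ^ K)"
      using a by (intro summable_divide) (simp add: summable_iff_shift)
  qed
  also have "\<dots> = (exp (s * \<bar>z\<bar>) - (\<Sum>k<K. a k)) / s ^ K"
    using a by (simp add: suminf_divide summable_iff_shift suminf_minus_initial_segment)
  also have "\<dots> \<le> exp (s * \<bar>z\<bar>) / s ^ K"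
    using assms by (intro divide_right_mono) (auto simp: a_def intro!: sum_nonneg)
  finally show ?thesis using suminf_minus_initial_segment[OF b(1), of K] b(2) by (simp add: b_def)
qed

text \<open>
  In the variable \<open>u i\<close> the truncated exponential series is a polynomial of degree at most
  \<open>2 * (K - 1)\<close>, with coefficients that depend on \<open>y\<close>.
\<close>

lemma sum_polynomial_eq_of_moments:
  fixes u v :: "'i \<Rightarrow> real"
  assumes "\<And>k. k < 2 * K \<Longrightarrow> (\<Sum>i\<in>A. u i ^ k) = (\<Sum>i\<in>A. v i ^ k)"
  shows "(\<Sum>i\<in>A. \<Sum>k<K. (y * u i - (u i)\<^sup>2 / 2) ^ k / fact k)
       = (\<Sum>i\<in>A. \<Sum>k<K. (y * v i - (v i)\<^sup>2 / 2) ^ k / fact k)"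
proof -
  have expand: "(y * t - t\<^sup>2 / 2) ^ k
      = (\<Sum>r\<le>k. of_nat (k choose r) * (- 1 / 2) ^ r * y ^ (k - r) * t ^ (k + r))" for t k
  proof -
    have "(y * t - t\<^sup>2 / 2) ^ k = t ^ k * ((- 1 / 2) * t + y) ^ k"
      by (simp add: power_mult_distrib[symmetric] power2_eq_square algebra_simps)
    also have "\<dots> = (\<Sum>r\<le>k. of_nat (k choose r) * (- 1 / 2) ^ r * y ^ (k - r) * t ^ (k + r))"
      unfolding binomial_ring sum_distrib_left
      by (intro sum.cong) (simp_all only: power_mult_distrib power_add mult_ac)
    finally show ?thesis .
  qed
  have swap: "(\<Sum>i\<in>A. \<Sum>k<K. (y * w i - (w i)\<^sup>2 / 2) ^ k / fact k)
      = (\<Sum>k<K. (\<Sum>r\<le>k. of_nat (k choose r) * (- 1 / 2) ^ r * y ^ (k - r) * (\<Sum>i\<in>A. w i ^ (k + r)))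
           / fact k)" for w :: "'i \<Rightarrow> real"
  proof -
    have "(\<Sum>i\<in>A. \<Sum>k<K. (y * w i - (w i)\<^sup>2 / 2) ^ k / fact k)
        = (\<Sum>k<K. (\<Sum>i\<in>A. (y * w i - (w i)\<^sup>2 / 2) ^ k) / fact k)"
      by (subst sum.swap) (simp add: sum_divide_distrib)
    also have "\<dots> = (\<Sum>k<K. (\<Sum>r\<le>k. of_nat (k choose r) * (- 1 / 2) ^ r * y ^ (k - r) * (\<Sum>i\<in>A. w i ^ (k + r)))
           / fact k)" (is "(\<Sum>k<K. ?l k / _) = (\<Sum>k<K. ?r k / _)")
    proof -
      have "?l k = ?r k" for k
        unfolding expand by (subst sum.swap) (simp add: sum_distrib_left)
      then show ?thesis by simp
    qed
    finally show ?thesis .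
  qed
  show ?thesis
    unfolding swap by (intro sum.cong refl arg_cong2[of _ _ _ _ "(/)"] arg_cong2[of _ _ _ _ "(*)"] assms) auto
qed

text \<open>
  The exponential is the likelihood ratio of \<open>N(u i, 1)\<close> to \<open>N(0, 1)\<close> at \<open>y\<close>. Its Taylor
  polynomial contributes the same to both sums, so only the two remainders are left.
\<close>

lemma sum_exp_tilt_close:
  fixes u v :: "'i \<Rightarrow> real"
  assumes "\<And>k. k < 2 * K \<Longrightarrow> (\<Sum>i\<in>A. u i ^ k) = (\<Sum>i\<in>A. v i ^ k)"
    and u: "\<And>i. i \<in> A \<Longrightarrow> \<bar>u i\<bar> \<le> V" and v: "\<And>i. i \<in> A \<Longrightarrow> \<bar>v i\<bar> \<le> V" and "s \<ge> 1"
  shows "\<bar>(\<Sum>i\<in>A. exp (y * u i - (u i)\<^sup>2 / 2)) - (\<Sum>i\<in>A. exp (y * v i - (v i)\<^sup>2 / 2))\<bar>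
          \<le> 2 * real (card A) * exp (s * (V * \<bar>y\<bar> + V\<^sup>2 / 2)) / s ^ K"
proof -
  define P where "P = (\<lambda>t::real. \<Sum>k<K. (y * t - t\<^sup>2 / 2) ^ k / fact k)"
  define R where "R = exp (s * (V * \<bar>y\<bar> + V\<^sup>2 / 2)) / s ^ K"
  have remainder: "\<bar>exp (y * t - t\<^sup>2 / 2) - P t\<bar> \<le> R" if "\<bar>t\<bar> \<le> V" for t
  proof -
    have "\<bar>y * t - t\<^sup>2 / 2\<bar> \<le> \<bar>t\<bar> * \<bar>y\<bar> + \<bar>t\<bar>\<^sup>2 / 2"
      by (rule order_trans[OF abs_triangle_ineq4]) (simp add: abs_mult)
    also have "\<dots> \<le> V * \<bar>y\<bar> + V\<^sup>2 / 2"
      using that by (intro add_mono mult_right_mono divide_right_mono power_mono) auto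
    finally have "exp (s * \<bar>y * t - t\<^sup>2 / 2\<bar>) \<le> exp (s * (V * \<bar>y\<bar> + V\<^sup>2 / 2))"
      using assms(4) by simp
    then have "exp (s * \<bar>y * t - t\<^sup>2 / 2\<bar>) / s ^ K \<le> R"
      using assms(4) unfolding R_def by (intro divide_right_mono) auto
    then show ?thesis
      using abs_exp_minus_taylor_le[OF assms(4), of "y * t - t\<^sup>2 / 2" K] by (simp add: P_def)
  qed
  have sum_remainder: "\<bar>(\<Sum>i\<in>A. exp (y * w i - (w i)\<^sup>2 / 2) - P (w i))\<bar> \<le> real (card A) * R"
    if "\<And>i. i \<in> A \<Longrightarrow> \<bar>w i\<bar> \<le> V" for w
    by (rule order_trans[OF sum_abs], rule sum_bounded_above) (auto intro: remainder that)
  have "(\<Sum>i\<in>A. P (u i)) = (\<Sum>i\<in>A. P (v i))"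
    unfolding P_def by (rule sum_polynomial_eq_of_moments) (rule assms)
  then have "\<bar>(\<Sum>i\<in>A. exp (y * u i - (u i)\<^sup>2 / 2)) - (\<Sum>i\<in>A. exp (y * v i - (v i)\<^sup>2 / 2))\<bar>
      \<le> real (card A) * R + real (card A) * R"
    using sum_remainder[of u, OF u] sum_remainder[of v, OF v] unfolding sum_subtractf by linarith
  then show ?thesis by (simp add: R_def)
qed

lemma prob_space_std_gaussian: "prob_space std_gaussian"
  unfolding std_gaussian_def by (rule prob_space_normal_density) simp

lemma sets_std_gaussian [simp, measurable_cong]: "sets std_gaussian = sets borel"
  by (simp add: std_gaussian_def)

lemma space_std_gaussian [simp]: "space std_gaussian = UNIV"
  by (simp add: std_gaussian_def)

lemma normal_density_shift:
  "normal_density u 1 y = std_normal_density y * exp (y * u - u\<^sup>2 / 2)"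
  by (simp add: normal_density_def exp_add[symmetric] power2_eq_square field_simps)

text \<open>
  The translation is moved from the integrand to the density, so that smoothing at different
  nodes becomes integration of one function against different densities.
\<close>

lemma integral_shifted_std_gaussian:
  fixes \<psi> :: "real \<Rightarrow> real"
  assumes [measurable]: "\<psi> \<in> borel_measurable borel"
  shows "(\<integral>t. \<psi> (u + t) \<partial>std_gaussian) = (\<integral>y. \<psi> y * normal_density u 1 y \<partial>lborel)"
proof -
  have "(\<integral>t. \<psi> (u + t) \<partial>std_gaussian) = (\<integral>t. std_normal_density t * \<psi> (u + t) \<partial>lborel)"
    unfolding std_gaussian_def by (subst integral_density) auto
  also have "\<dots> = (\<integral>t. \<psi> (u + 1 * t) * normal_density u 1 (u + 1 * t) \<partial>lborel)"
    by (intro Bochner_Integration.integral_cong) (auto simp: normal_density_def)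
  also have "\<dots> = (\<integral>y. \<psi> y * normal_density u 1 y \<partial>lborel)"
    using lborel_integral_real_affine[of 1 "\<lambda>y. \<psi> y * normal_density u 1 y" u] by simp
  finally show ?thesis .
qed

text \<open>
  Completing the square: the integrand is a multiple of the density of \<open>N(c, 1)\<close>.
\<close>

lemma std_normal_exp_moment:
  "integrable lborel (\<lambda>y. std_normal_density y * exp (c * y))"
  "(\<integral>y. std_normal_density y * exp (c * y) \<partial>lborel) = exp (c\<^sup>2 / 2)"
proof -
  have "std_normal_density y * exp (c * y) = exp (c\<^sup>2 / 2) * normal_density c 1 y" for y
    unfolding normal_density_shift[of c y] by (simp add: exp_diff mult.commute)
  then show "integrable lborel (\<lambda>y. std_normal_density y * exp (c * y))"
    "(\<integral>y. std_normal_density y * exp (c * y) \<partial>lborel) = exp (c\<^sup>2 / 2)"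
    by simp_all
qed

text \<open>
  No test function bounded by \<open>B\<close> can tell apart single observations from the two Gaussian
  mixtures, up to the stated error. Dominating \<open>exp (s * V * \<bar>y\<bar>)\<close> by the sum of
  the exponentials of \<open>s * V * y\<close> and \<open>- s * V * y\<close> reduces the integrated remainder to
  Gaussian exponential moments. With \<open>s\<close> of order \<open>sqrt K / V\<close> the error is about \<open>K powr (-
  K / 2)\<close> up to exponential factors.
\<close>

lemma gaussian_smoothing_close:
  fixes u v :: "'i \<Rightarrow> real" and \<psi> :: "real \<Rightarrow> real"
  assumes moments: "\<And>k. k < 2 * K \<Longrightarrow> (\<Sum>i\<in>A. u i ^ k) = (\<Sum>i\<in>A. v i ^ k)"
    and u: "\<And>i. i \<in> A \<Longrightarrow> \<bar>u i\<bar> \<le> V" and v: "\<And>i. i \<in> A \<Longrightarrow> \<bar>v i\<bar> \<le> V" and "s \<ge> 1" and "V \<ge> 0"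
    and \<psi> [measurable]: "\<psi> \<in> borel_measurable borel" and \<psi>_le: "\<And>y. \<bar>\<psi> y\<bar> \<le> B"
  shows "\<bar>(\<Sum>i\<in>A. \<integral>t. \<psi> (u i + t) \<partial>std_gaussian) - (\<Sum>i\<in>A. \<integral>t. \<psi> (v i + t) \<partial>std_gaussian)\<bar>
          \<le> real (card A) * (4 * B * exp ((s + s\<^sup>2) * V\<^sup>2 / 2) / s ^ K)"
proof -
  define E :: "('i \<Rightarrow> real) \<Rightarrow> real \<Rightarrow> real"
    where "E = (\<lambda>w y. \<Sum>i\<in>A. exp (y * w i - (w i)\<^sup>2 / 2))"
  define C where "C = B * (2 * real (card A) * exp (s * V\<^sup>2 / 2) / s ^ K)"
  have B: "B \<ge> 0" using \<psi>_le[of 0] by linarith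
  have C: "C \<ge> 0" unfolding C_def using B assms(4) by (intro mult_nonneg_nonneg divide_nonneg_nonneg) auto
  have int1: "integrable lborel (\<lambda>y. \<psi> y * normal_density c 1 y)" for c
  proof (rule Bochner_Integration.integrable_bound)
    show "integrable lborel (\<lambda>y. B * normal_density c 1 y)" by simp
    show "AE y in lborel. norm (\<psi> y * normal_density c 1 y) \<le> norm (B * normal_density c 1 y)"
      using \<psi>_le B by (auto simp: abs_mult intro!: mult_right_mono)
  qed simp
  have E: "(\<Sum>i\<in>A. \<integral>t. \<psi> (w i + t) \<partial>std_gaussian) = (\<integral>y. \<psi> y * std_normal_density y * E w y \<partial>lborel)"
    "integrable lborel (\<lambda>y. \<psi> y * std_normal_density y * E w y)" for w
  proof -
    have eq: "\<psi> y * std_normal_density y * E w y = (\<Sum>i\<in>A. \<psi> y * normal_density (w i) 1 y)" for y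
      unfolding E_def sum_distrib_left
      by (intro sum.cong refl, subst (2) normal_density_shift) (simp only: mult.assoc)
    show "integrable lborel (\<lambda>y. \<psi> y * std_normal_density y * E w y)"
      unfolding eq by (intro Bochner_Integration.integrable_sum int1)
    show "(\<Sum>i\<in>A. \<integral>t. \<psi> (w i + t) \<partial>std_gaussian) = (\<integral>y. \<psi> y * std_normal_density y * E w y \<partial>lborel)"
      unfolding eq integral_shifted_std_gaussian[OF \<psi>]
      by (intro Bochner_Integration.integral_sum[symmetric] int1)
  qed
  have bound: "\<bar>\<psi> y * std_normal_density y * E u y - \<psi> y * std_normal_density y * E v y\<bar>
      \<le> C * (std_normal_density y * exp (s * V * y)) + C * (std_normal_density y * exp ((- s * V) * y))" for y
  proof -
    have "\<bar>E u y - E v y\<bar> \<le> 2 * real (card A) * exp (s * (V * \<bar>y\<bar> + V\<^sup>2 / 2)) / s ^ K"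
      unfolding E_def by (rule sum_exp_tilt_close) (fact assms)+
    also have "\<dots> = 2 * real (card A) * exp (s * V\<^sup>2 / 2) / s ^ K * exp (s * V * \<bar>y\<bar>)"
      by (simp add: exp_add distrib_left mult_ac)
    finally have "\<bar>\<psi> y\<bar> * \<bar>E u y - E v y\<bar>
        \<le> B * (2 * real (card A) * exp (s * V\<^sup>2 / 2) / s ^ K * exp (s * V * \<bar>y\<bar>))"
      using \<psi>_le B by (intro mult_mono) auto
    also have "\<dots> = C * exp (s * V * \<bar>y\<bar>)" by (simp add: C_def)
    also have "\<dots> \<le> C * (exp (s * V * y) + exp ((- s * V) * y))"
      using C by (intro mult_left_mono) (auto simp: abs_if)
    finally have "std_normal_density y * (\<bar>\<psi> y\<bar> * \<bar>E u y - E v y\<bar>)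
        \<le> std_normal_density y * (C * (exp (s * V * y) + exp ((- s * V) * y)))"
      by (intro mult_left_mono) auto
    moreover have "\<bar>\<psi> y * std_normal_density y * E u y - \<psi> y * std_normal_density y * E v y\<bar>
        = std_normal_density y * (\<bar>\<psi> y\<bar> * \<bar>E u y - E v y\<bar>)"
    proof -
      have "\<psi> y * std_normal_density y * E u y - \<psi> y * std_normal_density y * E v y
          = std_normal_density y * (\<psi> y * (E u y - E v y))"
        by (simp add: algebra_simps)
      then show ?thesis by (simp only: abs_mult) simp
    qed
    ultimately show ?thesis by (simp add: distrib_left mult_ac)
  qed
  have "\<bar>(\<Sum>i\<in>A. \<integral>t. \<psi> (u i + t) \<partial>std_gaussian) - (\<Sum>i\<in>A. \<integral>t. \<psi> (v i + t) \<partial>std_gaussian)\<bar>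
      = \<bar>\<integral>y. \<psi> y * std_normal_density y * E u y - \<psi> y * std_normal_density y * E v y \<partial>lborel\<bar>"
    unfolding E(1) by (subst Bochner_Integration.integral_diff[OF E(2) E(2)]) simp
  also have "\<dots> \<le> (\<integral>y. \<bar>\<psi> y * std_normal_density y * E u y - \<psi> y * std_normal_density y * E v y\<bar> \<partial>lborel)"
    by (rule integral_abs_bound)
  also have "\<dots> \<le> (\<integral>y. C * (std_normal_density y * exp (s * V * y))
                     + C * (std_normal_density y * exp ((- s * V) * y)) \<partial>lborel)"
  proof (rule integral_mono)
    show "integrable lborel (\<lambda>y. \<bar>\<psi> y * std_normal_density y * E u y - \<psi> y * std_normal_density y * E v y\<bar>)"
      by (intro integrable_abs Bochner_Integration.integrable_diff E(2))
    show "integrable lborel (\<lambda>y. C * (std_normal_density y * exp (s * V * y))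
                     + C * (std_normal_density y * exp ((- s * V) * y)))"
      by (intro Bochner_Integration.integrable_add integrable_mult_right std_normal_exp_moment)
  qed (rule bound)
  also have "\<dots> = C * exp ((s * V)\<^sup>2 / 2) + C * exp ((- s * V)\<^sup>2 / 2)"
    using std_normal_exp_moment[of "s * V"] std_normal_exp_moment[of "- s * V"]
    by (subst Bochner_Integration.integral_add) simp_all
  also have "\<dots> = real (card A) * (4 * B * exp ((s + s\<^sup>2) * V\<^sup>2 / 2) / s ^ K)"
    by (simp add: C_def power_mult_distrib distrib_right add_divide_distrib exp_add)
  finally show ?thesis .
qed

section \<open>Monotone functions with prescribed values and comparison of norms\<close>

text \<open>
  The graph of \<open>t powr p\<close> lies above its tangent at \<open>1\<close>.
\<close>

lemma bernoulli_powr: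
  fixes t p :: real
  assumes "t \<ge> 0" "p \<ge> 1"
  shows "1 + p * (t - 1) \<le> t powr p"
proof (cases "t = 0")
  case False
  have "t powr p - 1 powr p \<ge> p * (t - 1)"
    by (rule convex_on_imp_above_tangent[OF powr_convex[OF assms(2)]])
      (use assms False in \<open>auto intro!: derivative_eq_intros simp: interior_open\<close>)
  then show ?thesis by simp
qed (use assms in simp)

text \<open>
  Power means increase with the exponent, so it suffices to bound the risk for \<open>p = 1\<close>. The
  mean \<open>m\<close> is compared through the tangent inequality above at the ratios \<open>\<bar>g (x
  i)\<bar> / m\<close>, which also covers vanishing summands.
\<close>

lemma mean_abs_le_empirical_norm:
  assumes "n \<ge> 1" "p \<ge> 1"
  shows "(1 / real n) * (\<Sum>i=1..n. \<bar>g (x i)\<bar>) \<le> empirical_norm n x p g"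
proof -
  define m where "m = (1 / real n) * (\<Sum>i=1..n. \<bar>g (x i)\<bar>)"
  have "m \<ge> 0" unfolding m_def by (intro mult_nonneg_nonneg sum_nonneg) auto
  show ?thesis
  proof (cases "m = 0")
    case True
    then show ?thesis unfolding m_def[symmetric] by (simp add: empirical_norm_def)
  next
    case False
    with \<open>m \<ge> 0\<close> have m: "m > 0" by simp
    have sum_m: "(\<Sum>i=1..n. \<bar>g (x i)\<bar> / m) = real n"
    proof -
      have "(\<Sum>i=1..n. \<bar>g (x i)\<bar>) = real n * m" using assms by (simp add: m_def)
      then show ?thesis using m by (simp add: sum_divide_distrib[symmetric])
    qed
    have "(\<Sum>i=1..n. m powr p * (1 + p * (\<bar>g (x i)\<bar> / m - 1)))
        = m powr p * (real n + p * ((\<Sum>i=1..n. \<bar>g (x i)\<bar> / m) - real n))"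
      by (simp add: sum_distrib_left[symmetric] sum.distrib sum_subtractf)
    then have "m powr p * real n = (\<Sum>i=1..n. m powr p * (1 + p * (\<bar>g (x i)\<bar> / m - 1)))"
      unfolding sum_m by simp
    also have "\<dots> \<le> (\<Sum>i=1..n. \<bar>g (x i)\<bar> powr p)"
    proof (rule sum_mono)
      fix i
      have "m powr p * (1 + p * (\<bar>g (x i)\<bar> / m - 1)) \<le> m powr p * (\<bar>g (x i)\<bar> / m) powr p"
        using m assms by (intro mult_left_mono bernoulli_powr) auto
      also have "\<dots> = \<bar>g (x i)\<bar> powr p" using m by (simp add: powr_mult[symmetric])
      finally show "m powr p * (1 + p * (\<bar>g (x i)\<bar> / m - 1)) \<le> \<bar>g (x i)\<bar> powr p" .
    qed
    finally have "m powr p \<le> (1 / real n) * (\<Sum>i=1..n. \<bar>g (x i)\<bar> powr p)"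
      using assms by (simp add: field_simps)
    then have "(m powr p) powr (1 / p) \<le> empirical_norm n x p g"
      unfolding empirical_norm_def using assms by (intro powr_mono2) auto
    then show ?thesis using m assms by (simp add: powr_powr m_def)
  qed
qed

text \<open>
  An arbitrary assignment of values to the indices becomes one that a monotone function can
  attain, and its multiset of values stays the same.
\<close>

lemma exists_sorting_bijection:
  fixes U :: "nat \<Rightarrow> 'a::linorder"
  obtains \<sigma> where "bij_betw \<sigma> {1..n} {1..n}" "mono_on {1..n} (\<lambda>i. U (\<sigma> i))"
proof
  define xs where "xs = sort_key U [1..<Suc n]"
  have xs: "set xs = {1..n}" "length xs = n" "distinct xs" by (auto simp: xs_def)
  show "bij_betw (\<lambda>i. xs ! (i - 1)) {1..n} {1..n}"
  proof -
    have "bij_betw ((!) xs) {..<n} {1..n}" using bij_betw_nth[OF xs(3)] xs by simp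
    moreover have "bij_betw (\<lambda>i. i - 1) {1..n} {..<n}"
      by (rule bij_betwI[where g = Suc]) auto
    ultimately show ?thesis
      using bij_betw_trans[of "\<lambda>i. i - 1" "{1..n}" "{..<n}" "(!) xs"] by (simp add: comp_def)
  qed
  show "mono_on {1..n} (\<lambda>i. U (xs ! (i - 1)))"
  proof (rule mono_onI)
    fix i j assume "i \<in> {1..n}" "j \<in> {1..n}" "i \<le> j"
    moreover have "sorted (map U xs)" by (simp add: xs_def)
    ultimately show "U (xs ! (i - 1)) \<le> U (xs ! (j - 1))"
      using sorted_nth_mono[of "map U xs" "i - 1" "j - 1"] xs(2) by auto
  qed
qed

text \<open>
  The step function that takes the largest value attained so far, starting at the lower
  bound \<open>- V\<close>.
\<close>

lemma monotone_interpolation: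
  assumes x: "is_design n x" and W: "mono_on {1..n} W" "\<And>i. i \<in> {1..n} \<Longrightarrow> \<bar>W i\<bar> \<le> V" and "V \<ge> 0"
  obtains f where "f \<in> monotone_class V" "\<And>i. i \<in> {1..n} \<Longrightarrow> f (x i) = W i"
proof
  define f where "f = (\<lambda>t. Max (insert (- V) (W ` {i \<in> {1..n}. x i \<le> t})))"
  have "f s \<le> f t" if "s \<le> t" for s t
    unfolding f_def using that by (intro Max_mono) auto
  moreover have "\<bar>f t\<bar> \<le> V" for t
  proof -
    have "f t \<in> insert (- V) (W ` {i \<in> {1..n}. x i \<le> t})" unfolding f_def by (rule Max_in) auto
    then show ?thesis using W(2) assms(4) by auto
  qed
  ultimately show "f \<in> monotone_class V" by (auto simp: monotone_class_def mono_on_def)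
  show "f (x i) = W i" if i: "i \<in> {1..n}" for i
    unfolding f_def
  proof (rule Max_eqI)
    fix w assume "w \<in> insert (- V) (W ` {j \<in> {1..n}. x j \<le> x i})"
    then consider "w = - V" | j where "j \<in> {1..n}" "x j \<le> x i" "w = W j" by auto
    then show "w \<le> W i"
    proof cases
      case 1
      then show ?thesis using W(2)[OF i] by auto
    next
      case (2 j)
      have "j \<le> i"
        using x i 2 strict_mono_onD[of "{1..n}" x i j] unfolding is_design_def by fastforce
      then show ?thesis using 2 i W(1) by (auto simp: mono_on_def)
    qed
  qed (use i in auto)
qed

section \<open>Products of uniform distributions\<close>

lemma sum_PiE_insert:
  assumes "x \<notin> I"
  shows "(\<Sum>j\<in>PiE (insert x I) (\<lambda>_. A). F j) = (\<Sum>a\<in>A. \<Sum>j\<in>PiE I (\<lambda>_. A). F (j(x := a)))"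
proof -
  have "(\<Sum>j\<in>PiE (insert x I) (\<lambda>_. A). F j) = (\<Sum>(a, j)\<in>A \<times> PiE I (\<lambda>_. A). F (j(x := a)))"
    unfolding PiE_insert_eq
    by (subst sum.reindex[OF inj_combinator[OF assms]]) (simp add: comp_def case_prod_unfold)
  then show ?thesis by (simp add: sum.cartesian_product)
qed

lemma sum_PiE_coordinate:
  fixes h :: "'a \<Rightarrow> real"
  assumes "finite I" "i \<in> I"
  shows "(\<Sum>j\<in>PiE I (\<lambda>_. A). h (j i)) = real (card A) ^ (card I - 1) * (\<Sum>a\<in>A. h a)"
proof -
  have "I = insert i (I - {i})" using assms by auto
  then have "(\<Sum>j\<in>PiE I (\<lambda>_. A). h (j i)) = (\<Sum>j\<in>PiE (insert i (I - {i})) (\<lambda>_. A). h (j i))"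
    by simp
  also have "\<dots> = (\<Sum>a\<in>A. \<Sum>j\<in>PiE (I - {i}) (\<lambda>_. A). h a)"
    by (subst sum_PiE_insert) auto
  also have "\<dots> = real (card A) ^ (card I - 1) * (\<Sum>a\<in>A. h a)"
    using assms by (simp add: card_PiE sum_distrib_left)
  finally show ?thesis .
qed

text \<open>
  Replacing the coordinates one at a time: if exchanging the law of a single coordinate
  changes an average by at most \<open>\<delta>\<close>, exchanging all of them changes it by at most
  \<open>card I * \<delta>\<close>. The sums over \<open>PiE I (\<lambda>_. A)\<close> are unnormalised averages over
  independent uniform indices.
\<close>

lemma sum_PiE_hybrid:
  fixes \<Phi> :: "('i \<Rightarrow> 'b) \<Rightarrow> real" and u v :: "'a \<Rightarrow> 'b"
  assumes "finite I"
    and "\<And>i U. i \<in> I \<Longrightarrow> \<bar>(\<Sum>a\<in>A. \<Phi> (U(i := u a))) - (\<Sum>a\<in>A. \<Phi> (U(i := v a)))\<bar> \<le> real (card A) * \<delta>"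
  shows "\<bar>(\<Sum>j\<in>PiE I (\<lambda>_. A). \<Phi> (\<lambda>i\<in>I. u (j i))) - (\<Sum>j\<in>PiE I (\<lambda>_. A). \<Phi> (\<lambda>i\<in>I. v (j i)))\<bar>
          \<le> real (card I) * real (card A) ^ card I * \<delta>"
  using assms
proof (induction I arbitrary: \<Phi> rule: finite_induct)
  case empty
  then show ?case by simp
next
  case (insert x I)
  let ?P = "PiE I (\<lambda>_. A)"
  have update: "(\<lambda>i\<in>insert x I. w ((j(x := a)) i)) = (\<lambda>i\<in>I. w (j i))(x := w a)" for w :: "'a \<Rightarrow> 'b" and j a
    using insert.hyps by (auto simp: fun_eq_iff)
  \<comment> \<open>The first argument of \<open>S\<close> gives the law on \<open>I\<close>, the second the law of the new coordinate.\<close>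
  define S where "S = (\<lambda>w w'. \<Sum>a\<in>A. \<Sum>j\<in>?P. \<Phi> ((\<lambda>i\<in>I. w (j i))(x := w' a)))"
  have S: "(\<Sum>j\<in>PiE (insert x I) (\<lambda>_. A). \<Phi> (\<lambda>i\<in>insert x I. w (j i))) = S w w" for w
    unfolding S_def by (subst sum_PiE_insert[OF insert.hyps(2)]) (simp only: update)
  have "\<bar>S u u - S v u\<bar>
      \<le> (\<Sum>a\<in>A. \<bar>(\<Sum>j\<in>?P. \<Phi> ((\<lambda>i\<in>I. u (j i))(x := u a))) - (\<Sum>j\<in>?P. \<Phi> ((\<lambda>i\<in>I. v (j i))(x := u a)))\<bar>)"
    unfolding S_def sum_subtractf[symmetric] by (rule sum_abs)
  also have "\<dots> \<le> (\<Sum>a\<in>A. real (card I) * real (card A) ^ card I * \<delta>)"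
  proof (rule sum_mono, rule insert.IH)
    fix a i U assume "i \<in> I"
    then have "i \<noteq> x" using insert.hyps by auto
    then show "\<bar>(\<Sum>b\<in>A. \<Phi> (U(i := u b, x := u a))) - (\<Sum>b\<in>A. \<Phi> (U(i := v b, x := u a)))\<bar>
        \<le> real (card A) * \<delta>"
      using insert.prems[of i "U(x := u a)"] \<open>i \<in> I\<close>
      by (simp only: fun_upd_twist[OF \<open>i \<noteq> x\<close>] insert_iff simp_thms)
  qed
  finally have 1: "\<bar>S u u - S v u\<bar> \<le> real (card I) * real (card A) ^ card (insert x I) * \<delta>"
    using insert.hyps by (simp add: mult_ac)
  have swap: "S w w' = (\<Sum>j\<in>?P. \<Sum>a\<in>A. \<Phi> ((\<lambda>i\<in>I. w (j i))(x := w' a)))" for w w'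
    unfolding S_def by (rule sum.swap)
  have "\<bar>S v u - S v v\<bar> \<le> (\<Sum>j\<in>?P. \<bar>(\<Sum>a\<in>A. \<Phi> ((\<lambda>i\<in>I. v (j i))(x := u a))) - (\<Sum>a\<in>A. \<Phi> ((\<lambda>i\<in>I. v (j i))(x := v a)))\<bar>)"
    unfolding swap sum_subtractf[symmetric] by (rule sum_abs)
  also have "\<dots> \<le> (\<Sum>j\<in>?P. real (card A) * \<delta>)"
    by (intro sum_mono insert.prems) auto
  also have "\<dots> = real (card A) ^ card (insert x I) * \<delta>"
    using insert.hyps by (simp add: card_PiE)
  finally have "\<bar>S u u - S v v\<bar> \<le> real (card I) * real (card A) ^ card (insert x I) * \<delta>
      + real (card A) ^ card (insert x I) * \<delta>"
    using 1 by linarith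
  also have "\<dots> = real (card (insert x I)) * real (card A) ^ card (insert x I) * \<delta>"
    using insert.hyps by (simp add: algebra_simps)
  finally show ?case unfolding S .
qed

section \<open>Statistics of the multiset of responses\<close>

definition exchangeable_statistic :: "nat \<Rightarrow> ((nat \<Rightarrow> real) \<Rightarrow> real) \<Rightarrow> bool" where
  "exchangeable_statistic n F \<longleftrightarrow> F \<in> borel_measurable (\<Pi>\<^sub>M i\<in>{1..n}. borel) \<and>
     (\<forall>y y'. image_mset y (mset_set {1..n}) = image_mset y' (mset_set {1..n}) \<longrightarrow> F y = F y')"

lemma exchangeable_statistic_cong:
  assumes "exchangeable_statistic n F" "\<And>i. i \<in> {1..n} \<Longrightarrow> y i = y' i"
  shows "F y = F y'"
proof -
  have "image_mset y (mset_set {1..n}) = image_mset y' (mset_set {1..n})"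
    using assms(2) by (intro image_mset_cong) auto
  then show ?thesis using assms(1) unfolding exchangeable_statistic_def by blast
qed

lemma exchangeable_statistic_permute:
  assumes "exchangeable_statistic n F" "bij_betw \<sigma> {1..n} {1..n}"
  shows "F (\<lambda>i. y (\<sigma> i)) = F y"
proof -
  have "image_mset (\<lambda>i. y (\<sigma> i)) (mset_set {1..n}) = image_mset y (image_mset \<sigma> (mset_set {1..n}))"
    by (simp add: image_mset.compositionality comp_def)
  also have "image_mset \<sigma> (mset_set {1..n}) = mset_set {1..n}"
    using assms(2) by (metis bij_betw_def image_mset_mset_set)
  finally show ?thesis using assms(1) unfolding exchangeable_statistic_def by blast
qed

text \<open>
  The responses are functions on all of \<open>nat\<close>, whereas the product sigma-algebra lives on
  functions restricted to \<open>{1..n}\<close>; a statistic of the multiset does not notice the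
  restriction.
\<close>

lemma exchangeable_statistic_measurable:
  assumes F: "exchangeable_statistic n F"
    and meas: "\<And>i. i \<in> {1..n} \<Longrightarrow> (\<lambda>\<omega>. Y \<omega> i) \<in> borel_measurable M"
  shows "(\<lambda>\<omega>. F (Y \<omega>)) \<in> borel_measurable M"
proof -
  have "(\<lambda>\<omega>. \<lambda>i\<in>{1..n}. Y \<omega> i) \<in> M \<rightarrow>\<^sub>M (\<Pi>\<^sub>M i\<in>{1..n}. borel)"
    by (rule measurable_restrict) (rule meas)
  moreover have "F \<in> borel_measurable (\<Pi>\<^sub>M i\<in>{1..n}. borel)"
    using F unfolding exchangeable_statistic_def by (rule conjunct1)
  ultimately have "(\<lambda>\<omega>. F (\<lambda>i\<in>{1..n}. Y \<omega> i)) \<in> borel_measurable M"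
    by (rule measurable_compose)
  also have "(\<lambda>\<omega>. F (\<lambda>i\<in>{1..n}. Y \<omega> i)) = (\<lambda>\<omega>. F (Y \<omega>))"
    by (intro ext exchangeable_statistic_cong[OF F]) simp
  finally show ?thesis .
qed

lemma prob_space_noise: "prob_space (noise std_gaussian n)"
  unfolding noise_def by (intro prob_space_PiM prob_space_std_gaussian)

lemma noise_component_measurable:
  "i \<in> {1..n} \<Longrightarrow> (\<lambda>\<xi>. \<xi> i) \<in> borel_measurable (noise std_gaussian n)"
  unfolding noise_def by measurable

text \<open>
  The noise is exchangeable, so permuting the signal can be undone by permuting the noise.
\<close>

lemma integral_noise_permute:
  assumes F: "exchangeable_statistic n F" and \<sigma>: "bij_betw \<sigma> {1..n} {1..n}"
  shows "(\<integral>\<xi>. F (\<lambda>i. U (\<sigma> i) + \<xi> i) \<partial>noise std_gaussian n)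
       = (\<integral>\<xi>. F (\<lambda>i. U i + \<xi> i) \<partial>noise std_gaussian n)"
proof -
  let ?N = "noise std_gaussian n" and ?r = "\<lambda>\<xi>. \<lambda>i\<in>{1..n}. \<xi> (\<sigma> i)"
  have \<sigma>_in: "\<sigma> i \<in> {1..n}" if "i \<in> {1..n}" for i using \<sigma> that bij_betwE by blast
  have reindex: "distr ?N ?N ?r = ?N"
    unfolding noise_def
    using distr_PiM_reindex[of "{1..n}" "\<lambda>_. std_gaussian" \<sigma> "{1..n}"] prob_space_std_gaussian \<sigma>
    by (auto simp: bij_betw_def)
  have "(\<integral>\<xi>. F (\<lambda>i. U (\<sigma> i) + \<xi> i) \<partial>?N) = (\<integral>\<xi>. F (\<lambda>i. U (\<sigma> i) + \<xi> i) \<partial>distr ?N ?N ?r)"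
    by (simp only: reindex)
  also have "\<dots> = (\<integral>\<xi>. F (\<lambda>i. U (\<sigma> i) + ?r \<xi> i) \<partial>?N)"
  proof (rule integral_distr)
    show "?r \<in> ?N \<rightarrow>\<^sub>M ?N"
      unfolding noise_def using \<sigma>_in
      by (intro measurable_restrict measurable_component_singleton) auto
    show "(\<lambda>\<xi>. F (\<lambda>i. U (\<sigma> i) + \<xi> i)) \<in> borel_measurable ?N"
      by (rule exchangeable_statistic_measurable[OF F])
        (intro borel_measurable_add borel_measurable_const noise_component_measurable)
  qed
  also have "\<dots> = (\<integral>\<xi>. F (\<lambda>i. U i + \<xi> i) \<partial>?N)"
  proof (rule Bochner_Integration.integral_cong[OF refl])
    fix \<xi>
    have "F (\<lambda>i. U (\<sigma> i) + ?r \<xi> i) = F (\<lambda>i. (\<lambda>k. U k + \<xi> k) (\<sigma> i))"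
      by (intro exchangeable_statistic_cong[OF F]) simp
    also have "\<dots> = F (\<lambda>i. U i + \<xi> i)"
      by (rule exchangeable_statistic_permute[OF F \<sigma>])
    finally show "F (\<lambda>i. U (\<sigma> i) + ?r \<xi> i) = F (\<lambda>i. U i + \<xi> i)" .
  qed
  finally show ?thesis .
qed

text \<open>
  Conditionally on the noise in the other coordinates, a statistic is a bounded test
  function of the single observation \<open>i\<close>. An indistinguishability bound for one observation
  therefore integrates, by Fubini, to a bound for exchanging one coordinate of the signal.
\<close>

lemma noise_coordinate_swap_close:
  fixes u v :: "'i \<Rightarrow> real"
  assumes F: "exchangeable_statistic n F" and F_le: "\<And>y. \<bar>F y\<bar> \<le> B" and i: "i \<in> {1..n}"
    and close: "\<And>\<psi>. \<psi> \<in> borel_measurable borel \<Longrightarrow> (\<And>y. \<bar>\<psi> y\<bar> \<le> B) \<Longrightarrow>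
      \<bar>(\<Sum>a\<in>A. \<integral>t. \<psi> (u a + t) \<partial>std_gaussian) - (\<Sum>a\<in>A. \<integral>t. \<psi> (v a + t) \<partial>std_gaussian)\<bar> \<le> \<epsilon>"
  shows "\<bar>(\<Sum>a\<in>A. \<integral>\<xi>. F (\<lambda>k. (U(i := u a)) k + \<xi> k) \<partial>noise std_gaussian n)
        - (\<Sum>a\<in>A. \<integral>\<xi>. F (\<lambda>k. (U(i := v a)) k + \<xi> k) \<partial>noise std_gaussian n)\<bar> \<le> \<epsilon>"
proof -
  interpret N: prob_space std_gaussian by (rule prob_space_std_gaussian)
  interpret P: product_prob_space "\<lambda>_. std_gaussian" "{1..n} - {i}"
    by unfold_locales
  let ?M = "\<Pi>\<^sub>M k\<in>{1..n} - {i}. std_gaussian"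
  have M: "prob_space ?M" by (rule prob_space_PiM) (rule prob_space_std_gaussian)
  define \<psi> where "\<psi> = (\<lambda>\<xi> y. F ((\<lambda>k. U k + \<xi> k)(i := y)))"
  have insert_i: "{1..n} = insert i ({1..n} - {i})" using i by auto
  have bounded_integrable: "integrable Q G"
    if "prob_space Q" "G \<in> borel_measurable Q" "\<And>\<omega>. \<bar>G \<omega>\<bar> \<le> B" for Q :: "'q measure" and G
    using that by (intro finite_measure.integrable_const_bound[where B = B] prob_space.finite_measure) auto
  have \<psi>_joint: "(\<lambda>(\<xi>, t). \<psi> \<xi> (c + t)) \<in> borel_measurable (?M \<Otimes>\<^sub>M std_gaussian)" for c
    unfolding \<psi>_def case_prod_unfold
  proof (rule exchangeable_statistic_measurable[OF F])
    fix k assume "k \<in> {1..n}"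
    then show "(\<lambda>\<omega>. ((\<lambda>k. U k + fst \<omega> k)(i := c + snd \<omega>)) k) \<in> borel_measurable (?M \<Otimes>\<^sub>M std_gaussian)"
      by (cases "k = i") auto
  qed
  have shift: "(\<lambda>t. c + t) \<in> borel_measurable std_gaussian" for c :: real
    by measurable
  have \<psi>_bound: "\<bar>\<integral>t. \<psi> \<xi> (c + t) \<partial>std_gaussian\<bar> \<le> B" for \<xi> c
  proof -
    have "(\<lambda>t. \<psi> \<xi> (c + t)) \<in> borel_measurable std_gaussian"
      unfolding \<psi>_def
    proof (rule exchangeable_statistic_measurable[OF F])
      fix k show "(\<lambda>t. ((\<lambda>k. U k + \<xi> k)(i := c + t)) k) \<in> borel_measurable std_gaussian"
        using shift by (cases "k = i") simp_all
    qed
    then have int: "integrable std_gaussian (\<lambda>t. \<psi> \<xi> (c + t))"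
      using F_le by (intro bounded_integrable) (auto simp: \<psi>_def prob_space_std_gaussian)
    have "\<bar>\<integral>t. \<psi> \<xi> (c + t) \<partial>std_gaussian\<bar> \<le> (\<integral>t. \<bar>\<psi> \<xi> (c + t)\<bar> \<partial>std_gaussian)"
      by (rule integral_abs_bound)
    also have "\<dots> \<le> B"
      using int F_le by (intro N.integral_le_const) (auto simp: \<psi>_def)
    finally show ?thesis .
  qed
  have inner: "integrable ?M (\<lambda>\<xi>. \<integral>t. \<psi> \<xi> (c + t) \<partial>std_gaussian)" for c
    using \<psi>_joint[of c] \<psi>_bound
    by (intro bounded_integrable M N.borel_measurable_lebesgue_integral) auto
  have fubini: "(\<integral>\<xi>. F (\<lambda>k. (U(i := c)) k + \<xi> k) \<partial>noise std_gaussian n)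
      = (\<integral>\<xi>. (\<integral>t. \<psi> \<xi> (c + t) \<partial>std_gaussian) \<partial>?M)" for c
  proof -
    have "integrable (noise std_gaussian n) (\<lambda>\<xi>. F (\<lambda>k. (U(i := c)) k + \<xi> k))"
      using F_le
      by (intro bounded_integrable prob_space_noise exchangeable_statistic_measurable[OF F]
          borel_measurable_add borel_measurable_const noise_component_measurable) auto
    then have "(\<integral>\<xi>. F (\<lambda>k. (U(i := c)) k + \<xi> k) \<partial>noise std_gaussian n)
        = (\<integral>\<xi>. (\<integral>t. F (\<lambda>k. (U(i := c)) k + (\<xi>(i := t)) k) \<partial>std_gaussian) \<partial>?M)"
      unfolding noise_def by (subst (asm) insert_i, subst insert_i, subst P.product_integral_insert) auto
    moreover have "F (\<lambda>k. (U(i := c)) k + (\<xi>(i := t)) k) = \<psi> \<xi> (c + t)" for \<xi> t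
      unfolding \<psi>_def by (rule arg_cong[where f = F]) auto
    ultimately show ?thesis by simp
  qed
  let ?D = "\<lambda>\<xi>. (\<Sum>a\<in>A. \<integral>t. \<psi> \<xi> (u a + t) \<partial>std_gaussian) - (\<Sum>a\<in>A. \<integral>t. \<psi> \<xi> (v a + t) \<partial>std_gaussian)"
  have D_int: "integrable ?M ?D"
    by (intro Bochner_Integration.integrable_diff Bochner_Integration.integrable_sum inner)
  have outer: "(\<integral>\<xi>. (\<Sum>a\<in>A. \<integral>t. \<psi> \<xi> (w a + t) \<partial>std_gaussian) \<partial>?M)
      = (\<Sum>a\<in>A. \<integral>\<xi>. F (\<lambda>k. (U(i := w a)) k + \<xi> k) \<partial>noise std_gaussian n)" for w :: "'i \<Rightarrow> real"
    unfolding fubini by (intro Bochner_Integration.integral_sum inner)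
  have "(\<integral>\<xi>. ?D \<xi> \<partial>?M)
      = (\<Sum>a\<in>A. \<integral>\<xi>. F (\<lambda>k. (U(i := u a)) k + \<xi> k) \<partial>noise std_gaussian n)
        - (\<Sum>a\<in>A. \<integral>\<xi>. F (\<lambda>k. (U(i := v a)) k + \<xi> k) \<partial>noise std_gaussian n)"
    unfolding outer[symmetric]
    by (intro Bochner_Integration.integral_diff Bochner_Integration.integrable_sum inner)
  then have "\<bar>(\<Sum>a\<in>A. \<integral>\<xi>. F (\<lambda>k. (U(i := u a)) k + \<xi> k) \<partial>noise std_gaussian n)
        - (\<Sum>a\<in>A. \<integral>\<xi>. F (\<lambda>k. (U(i := v a)) k + \<xi> k) \<partial>noise std_gaussian n)\<bar>
      = \<bar>\<integral>\<xi>. ?D \<xi> \<partial>?M\<bar>"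
    by (simp only:)
  also have "\<dots> \<le> (\<integral>\<xi>. \<bar>?D \<xi>\<bar> \<partial>?M)" by (rule integral_abs_bound)
  also have "\<dots> \<le> \<epsilon>"
  proof (rule prob_space.integral_le_const[OF M])
    show "AE \<xi> in ?M. \<bar>?D \<xi>\<bar> \<le> \<epsilon>"
    proof (rule AE_I2)
      fix \<xi>
      have "\<psi> \<xi> \<in> borel_measurable borel"
        unfolding \<psi>_def
      proof (rule exchangeable_statistic_measurable[OF F])
        fix k show "(\<lambda>y. ((\<lambda>k. U k + \<xi> k)(i := y)) k) \<in> borel_measurable borel"
          by (cases "k = i") auto
      qed
      then show "\<bar>?D \<xi>\<bar> \<le> \<epsilon>" using F_le by (intro close) (auto simp: \<psi>_def)
    qed
  qed (use D_int in auto)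
  finally show ?thesis .
qed

section \<open>The lower bound for a fixed number of nodes\<close>

lemma integral_le_of_nn_integral_le:
  fixes G :: "'a \<Rightarrow> real"
  assumes "integrable M G" "(\<integral>\<^sup>+ \<omega>. ennreal (G \<omega>) \<partial>M) \<le> ennreal r" "r \<ge> 0"
  shows "(\<integral>\<omega>. G \<omega> \<partial>M) \<le> r"
proof -
  have "enn2real (\<integral>\<^sup>+ \<omega>. ennreal (G \<omega>) \<partial>M) \<le> enn2real (ennreal r)"
    using assms(2) by (intro enn2real_mono) auto
  then have "enn2real (\<integral>\<^sup>+ \<omega>. ennreal (G \<omega>) \<partial>M) \<le> r" using assms(3) by simp
  then show ?thesis
    unfolding real_lebesgue_integral_def[OF assms(1)] by (smt (verit) enn2real_nonneg)
qed

text \<open>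
  The argument compares two priors under which the values \<open>f (x i)\<close> are the increasing
  rearrangement of \<open>n\<close> independent uniform draws from the even, respectively odd, nodes. Let
  \<open>h\<close> be the distance to the even nodes. It is 1-Lipschitz, so the empirical mean of \<open>h\<close> at
  the estimate is within the loss of the empirical mean of \<open>h\<close> at the truth. The latter is
  zero under the first prior and \<open>V / (2 * N)\<close> or more on average under the second.
  Truncated at \<open>B\<close>, the statistic \<open>T\<close> has nearly the same expectation under both priors,
  hence it errs under one of them.
\<close>

lemma minimax_risk_ge:
  fixes V s p :: real and n K N :: nat
  assumes N: "N = 2 * K" and "K \<ge> 2" "n \<ge> 1" "V > 0" "s \<ge> 1" "p \<ge> 1" and x: "is_design n x"
  defines "\<delta> \<equiv> 4 * (V * pi / N) * exp ((s + s\<^sup>2) * V\<^sup>2 / 2) / s ^ K"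
  shows "ennreal (V / (4 * real N) - real n * \<delta> / 2) \<le> minimax_risk std_gaussian n x V p"
  unfolding minimax_risk_def
proof (rule INF_greatest)
  fix g assume g: "g \<in> estimators n x"
  let ?R = "SUP f\<in>monotone_class V. risk std_gaussian n x p g f"
  let ?N = "noise std_gaussian n"
  define u v where "u = cosine_node V N 0" and "v = cosine_node V N (pi / N)"
  define h where "h = (\<lambda>t. infdist t (even_nodes V N))"
  define B where "B = V * pi / N"
  \<comment> \<open>Truncation at \<open>B\<close>, an upper bound for \<open>h\<close> at the odd nodes, makes \<open>T\<close> a bounded test function.\<close>
  define T where "T = (\<lambda>y. min B ((1 / real n) * (\<Sum>i=1..n. h (g (uncoupled_data n x y) (x i)))))"
  define \<Phi> where "\<Phi> = (\<lambda>U. \<integral>\<xi>. T (\<lambda>i. U i + \<xi> i) \<partial>?N)"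
  define loss where "loss = (\<lambda>f \<xi>. empirical_norm n x p
      (\<lambda>t. f t - g (uncoupled_data n x (\<lambda>i. f (x i) + \<xi> i)) t))"
  have N_pos: "N > 2" using assms by auto
  have B_pos: "B \<ge> 0" using assms by (simp add: B_def)
  have h_lipschitz: "h a \<le> h b + \<bar>a - b\<bar>" for a b
    using infdist_triangle[of a _ b] by (simp add: h_def dist_real_def)
  have h_nonneg: "h a \<ge> 0" for a by (simp add: h_def infdist_nonneg)
  have h_measurable: "h \<in> borel_measurable borel"
    unfolding h_def by (intro borel_measurable_continuous_onI continuous_intros)
  have T_nonneg: "T y \<ge> 0" and T_le: "T y \<le> B" for y
    using B_pos by (auto simp: T_def intro!: divide_nonneg_nonneg sum_nonneg h_nonneg)
  have T_abs: "\<bar>T y\<bar> \<le> B" for y using T_nonneg[of y] T_le[of y] by simp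
  have T: "exchangeable_statistic n T"
    unfolding exchangeable_statistic_def
  proof (intro conjI allI impI)
    have "(\<lambda>y. h (g (uncoupled_data n x y) (x i))) \<in> borel_measurable (\<Pi>\<^sub>M i\<in>{1..n}. borel)"
      if "i \<in> {1..n}" for i
      using g x that unfolding estimators_def is_design_def
      by (intro measurable_compose[OF _ h_measurable]) blast
    then show "T \<in> borel_measurable (\<Pi>\<^sub>M i\<in>{1..n}. borel)"
      unfolding T_def by (intro borel_measurable_min borel_measurable_times borel_measurable_sum) auto
  qed (simp add: T_def uncoupled_data_def)
  have T_int: "integrable ?N (\<lambda>\<xi>. T (\<lambda>i. U i + \<xi> i))" for U
    using T_abs
    by (intro finite_measure.integrable_const_bound[where B = B]
          prob_space.finite_measure[OF prob_space_noise] exchangeable_statistic_measurable[OF T]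
          borel_measurable_add borel_measurable_const noise_component_measurable) auto
  show "ennreal (V / (4 * real N) - real n * \<delta> / 2) \<le> ?R"
  proof (cases ?R)
    case top
    then show ?thesis by (simp only: top_greatest)
  next
    case (real r)
    have loss_le: "(1 / real n) * (\<Sum>i=1..n. \<bar>f (x i) - g (uncoupled_data n x (\<lambda>i. f (x i) + \<xi> i)) (x i)\<bar>)
        \<le> loss f \<xi>" for f \<xi>
      unfolding loss_def using assms by (intro mean_abs_le_empirical_norm) auto
    have le_r: "(\<integral>\<xi>. G \<xi> \<partial>?N) \<le> r"
      if "f \<in> monotone_class V" "integrable ?N G" "\<And>\<xi>. G \<xi> \<le> loss f \<xi>" for f G
    proof (rule integral_le_of_nn_integral_le[OF that(2)])
      have "(\<integral>\<^sup>+ \<xi>. ennreal (G \<xi>) \<partial>?N) \<le> risk std_gaussian n x p g f"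
        unfolding risk_def loss_def[symmetric]
        using that(3) by (intro nn_integral_mono ennreal_leI) (simp add: loss_def)
      also have "\<dots> \<le> ?R" using that(1) by (rule SUP_upper)
      finally show "(\<integral>\<^sup>+ \<xi>. ennreal (G \<xi>) \<partial>?N) \<le> ennreal r" using real by simp
    qed (use real in simp)
    \<comment> \<open>Uncoupling: the increasing rearrangement of the values is attained by a monotone function.\<close>
    have realise: "\<exists>f\<in>monotone_class V. \<exists>\<sigma>. bij_betw \<sigma> {1..n} {1..n} \<and> (\<forall>i\<in>{1..n}. f (x i) = U (\<sigma> i))"
      if U: "\<And>i. i \<in> {1..n} \<Longrightarrow> \<bar>U i\<bar> \<le> V" for U
    proof -
      obtain \<sigma> where \<sigma>: "bij_betw \<sigma> {1..n} {1..n}" "mono_on {1..n} (\<lambda>i. U (\<sigma> i))"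
        by (rule exists_sorting_bijection)
      have "\<bar>U (\<sigma> i)\<bar> \<le> V" if "i \<in> {1..n}" for i using U \<sigma>(1) that bij_betwE by blast
      then obtain f where "f \<in> monotone_class V" "\<And>i. i \<in> {1..n} \<Longrightarrow> f (x i) = U (\<sigma> i)"
        using monotone_interpolation[OF x \<sigma>(2)] assms by (metis less_imp_le)
      then show ?thesis using \<sigma>(1) by blast
    qed
    have \<Phi>_eq: "\<Phi> U = (\<integral>\<xi>. T (\<lambda>i. f (x i) + \<xi> i) \<partial>?N)"
      if "bij_betw \<sigma> {1..n} {1..n}" "\<forall>i\<in>{1..n}. f (x i) = U (\<sigma> i)" for U f \<sigma>
    proof -
      have "\<Phi> U = (\<integral>\<xi>. T (\<lambda>i. U (\<sigma> i) + \<xi> i) \<partial>?N)"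
        unfolding \<Phi>_def by (rule integral_noise_permute[OF T that(1), symmetric])
      also have "\<dots> = (\<integral>\<xi>. T (\<lambda>i. f (x i) + \<xi> i) \<partial>?N)"
        using that(2) by (intro Bochner_Integration.integral_cong refl exchangeable_statistic_cong[OF T]) simp
      finally show ?thesis .
    qed
    have u_le: "\<bar>u a\<bar> \<le> V" and v_le: "\<bar>v a\<bar> \<le> V" for a
      using assms by (auto simp: u_def v_def intro!: abs_cosine_node_le)
    \<comment> \<open>Here \<open>h\<close> vanishes at the truth, so \<open>T\<close> is itself a lower bound for the loss.\<close>
    have even_case: "\<Phi> U \<le> r" if U: "\<And>i. i \<in> {1..n} \<Longrightarrow> U i \<in> u ` {..<N}" for U
    proof -
      have "\<bar>U i\<bar> \<le> V" if "i \<in> {1..n}" for i using U[OF that] u_le by auto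
      from realise[of U, OF this] obtain f \<sigma> where f: "f \<in> monotone_class V"
        and \<sigma>: "bij_betw \<sigma> {1..n} {1..n}" and f_x: "\<forall>i\<in>{1..n}. f (x i) = U (\<sigma> i)"
        by blast
      have "T (\<lambda>i. f (x i) + \<xi> i) \<le> loss f \<xi>" for \<xi>
      proof -
        let ?g = "g (uncoupled_data n x (\<lambda>i. f (x i) + \<xi> i))"
        have "h (?g (x i)) \<le> \<bar>f (x i) - ?g (x i)\<bar>" if "i \<in> {1..n}" for i
        proof -
          have "f (x i) \<in> even_nodes V N"
            using U f_x \<sigma> that bij_betwE unfolding even_nodes_def u_def by metis
          then have "h (f (x i)) = 0" by (simp add: h_def)
          then show ?thesis using h_lipschitz[of "?g (x i)" "f (x i)"] by simp
        qed
        then have "(1 / real n) * (\<Sum>i=1..n. h (?g (x i))) \<le> (1 / real n) * (\<Sum>i=1..n. \<bar>f (x i) - ?g (x i)\<bar>)"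
          by (intro mult_left_mono sum_mono) auto
        then show ?thesis using loss_le[of f \<xi>] unfolding T_def by linarith
      qed
      then show ?thesis unfolding \<Phi>_eq[OF \<sigma> f_x] by (intro le_r[OF f] T_int)
    qed
    \<comment> \<open>Here the mean of \<open>h\<close> at the truth is at most \<open>B\<close>, so the truncation cannot raise its excess over \<open>T\<close> above the loss.\<close>
    have odd_case: "(1 / real n) * (\<Sum>i=1..n. h (U i)) - \<Phi> U \<le> r"
      if U: "\<And>i. i \<in> {1..n} \<Longrightarrow> U i \<in> v ` {..<N}" for U
    proof -
      have "\<bar>U i\<bar> \<le> V" if "i \<in> {1..n}" for i using U[OF that] v_le by auto
      from realise[of U, OF this] obtain f \<sigma> where f: "f \<in> monotone_class V"
        and \<sigma>: "bij_betw \<sigma> {1..n} {1..n}" and f_x: "\<forall>i\<in>{1..n}. f (x i) = U (\<sigma> i)"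
        by blast
      define H where "H = (1 / real n) * (\<Sum>i=1..n. h (f (x i)))"
      have H: "H = (1 / real n) * (\<Sum>i=1..n. h (U i))"
        unfolding H_def using f_x sum.reindex_bij_betw[OF \<sigma>, of "\<lambda>i. h (U i)"] by simp
      have "h (U i) \<le> B" if "i \<in> {1..n}" for i
      proof -
        from U[OF that] obtain a where "a < N" "U i = v a" by auto
        then show ?thesis
          unfolding h_def v_def B_def using infdist_odd_node_le[of V a N] assms(4) by simp
      qed
      then have "(\<Sum>i=1..n. h (U i)) \<le> real (card {1..n}) * B" by (intro sum_bounded_above)
      then have H_le: "H \<le> B" unfolding H using assms by (simp add: field_simps)
      have "H - T (\<lambda>i. f (x i) + \<xi> i) \<le> loss f \<xi>" for \<xi>
      proof -
        let ?g = "g (uncoupled_data n x (\<lambda>i. f (x i) + \<xi> i))"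
        have "H \<le> (1 / real n) * (\<Sum>i=1..n. h (?g (x i)) + \<bar>f (x i) - ?g (x i)\<bar>)"
          unfolding H_def by (intro mult_left_mono sum_mono h_lipschitz) auto
        also have "\<dots> = (1 / real n) * (\<Sum>i=1..n. h (?g (x i))) + (1 / real n) * (\<Sum>i=1..n. \<bar>f (x i) - ?g (x i)\<bar>)"
          by (simp only: sum.distrib distrib_left)
        finally have "H - (1 / real n) * (\<Sum>i=1..n. h (?g (x i))) \<le> loss f \<xi>"
          using loss_le[of f \<xi>] by linarith
        moreover have "0 \<le> loss f \<xi>" by (simp add: loss_def empirical_norm_def)
        ultimately show ?thesis using H_le unfolding T_def by linarith
      qed
      then have "(\<integral>\<xi>. H - T (\<lambda>i. f (x i) + \<xi> i) \<partial>?N) \<le> r"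
        using T_int by (intro le_r[OF f]) (auto intro!: Bochner_Integration.integrable_diff
            finite_measure.integrable_const prob_space.finite_measure prob_space_noise)
      moreover have "(\<integral>\<xi>. H - T (\<lambda>i. f (x i) + \<xi> i) \<partial>?N) = H - \<Phi> U"
        using T_int unfolding \<Phi>_eq[OF \<sigma> f_x]
        by (subst Bochner_Integration.integral_diff)
          (auto simp: prob_space.prob_space[OF prob_space_noise] intro!: finite_measure.integrable_const
             prob_space.finite_measure prob_space_noise)
      ultimately show ?thesis by (simp add: H)
    qed
    let ?P = "PiE {1..n} (\<lambda>_. {..<N})"
    let ?u = "\<lambda>j. \<lambda>i\<in>{1..n}. u (j i)" and ?v = "\<lambda>j. \<lambda>i\<in>{1..n}. v (j i)"
    have card_P: "real (card ?P) = real N ^ n" by (simp add: card_PiE)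
    have "\<bar>(\<Sum>j\<in>?P. \<Phi> (?u j)) - (\<Sum>j\<in>?P. \<Phi> (?v j))\<bar>
        \<le> real (card {1..n}) * real (card {..<N}) ^ card {1..n} * \<delta>"
    proof (rule sum_PiE_hybrid, simp)
      fix i U assume i: "i \<in> {1..n}"
      show "\<bar>(\<Sum>a<N. \<Phi> (U(i := u a))) - (\<Sum>a<N. \<Phi> (U(i := v a)))\<bar> \<le> real (card {..<N}) * \<delta>"
        unfolding \<Phi>_def
      proof (rule noise_coordinate_swap_close[OF T T_abs i])
        fix \<psi> :: "real \<Rightarrow> real"
        assume \<psi>: "\<psi> \<in> borel_measurable borel" "\<And>y. \<bar>\<psi> y\<bar> \<le> B"
        show "\<bar>(\<Sum>a<N. \<integral>t. \<psi> (u a + t) \<partial>std_gaussian) - (\<Sum>a<N. \<integral>t. \<psi> (v a + t) \<partial>std_gaussian)\<bar>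
            \<le> real (card {..<N}) * \<delta>"
          unfolding \<delta>_def B_def[symmetric] using assms
          by (intro gaussian_smoothing_close[where V = V] \<psi> u_le v_le)
            (auto simp: u_def v_def intro!: cosine_node_moments)
      qed
    qed
    \<comment> \<open>The prior averages of \<open>\<Phi>\<close> agree up to \<open>n * \<delta>\<close>; the factor \<open>N ^ n\<close> counts the assignments.\<close>
    then have hybrid: "(\<Sum>j\<in>?P. \<Phi> (?v j)) \<le> (\<Sum>j\<in>?P. \<Phi> (?u j)) + real n * real N ^ n * \<delta>"
      by simp
    \<comment> \<open>Averaging the two cases over the priors: the risk cannot be small in both.\<close>
    have "(\<Sum>j\<in>?P. \<Phi> (?u j)) \<le> real N ^ n * r"
      unfolding card_P[symmetric] by (rule sum_bounded_above, rule even_case) auto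
    moreover have "(\<Sum>j\<in>?P. (1 / real n) * (\<Sum>i=1..n. h (?v j i)) - \<Phi> (?v j)) \<le> real N ^ n * r"
      unfolding card_P[symmetric] by (rule sum_bounded_above, rule odd_case) auto
    moreover have "(\<Sum>j\<in>?P. (1 / real n) * (\<Sum>i=1..n. h (?v j i))) = real N ^ (n - 1) * (\<Sum>a<N. h (v a))"
    proof -
      have "(\<Sum>j\<in>?P. (1 / real n) * (\<Sum>i=1..n. h (?v j i)))
          = (1 / real n) * (\<Sum>i=1..n. \<Sum>j\<in>?P. h (v (j i)))"
        by (subst sum.swap) (simp add: sum_divide_distrib)
      also have "\<dots> = (1 / real n) * (\<Sum>i=1..n. real N ^ (n - 1) * (\<Sum>a<N. h (v a)))"
        using sum_PiE_coordinate[where I = "{1..n}" and A = "{..<N}" and h = "\<lambda>a. h (v a)"] by simp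
      finally show ?thesis using assms by simp
    qed
    moreover have "real N ^ (n - 1) * (V / 2) \<le> real N ^ (n - 1) * (\<Sum>a<N. h (v a))"
      using sum_infdist_odd_nodes_ge[of V N] N_pos assms
      by (intro mult_left_mono) (auto simp: h_def v_def)
    moreover have "real N ^ (n - 1) * (V / 2) = real N ^ n * (V / (2 * real N))"
      using N_pos assms by (cases n) auto
    ultimately have "real N ^ n * (V / (2 * real N)) \<le> real N ^ n * (2 * r + real n * \<delta>)"
      using hybrid by (simp add: sum_subtractf algebra_simps)
    moreover have "real N ^ n > 0" using N_pos by simp
    ultimately have "V / (2 * real N) \<le> 2 * r + real n * \<delta>"
      by (simp only: mult_le_cancel_left_pos)
    then have "V / (4 * real N) - real n * \<delta> / 2 \<le> r" by simp
    then show ?thesis using real by (simp add: ennreal_leI)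
  qed
qed

section \<open>Choice of the number of nodes\<close>

text \<open>
  The witness is \<open>K \<approx> 4 * ln n / ln (ln n)\<close>. Then \<open>ln K\<close> is asymptotic to \<open>ln (ln
  n)\<close>, so that \<open>(sqrt K) ^ K\<close> is about \<open>n\<^sup>2\<close>: this outweighs the factor \<open>n\<close> together
  with the exponential factors \<open>exp K\<close> and \<open>V ^ K\<close>. The constant \<open>3 / 8\<close> in place of \<open>1 / 2\<close>
  leaves the room for these, and still gives \<open>n powr (3 / 2)\<close>.
\<close>

lemma eventually_node_count:
  fixes V :: real
  assumes "V > 0"
  shows "\<forall>\<^sub>F n :: nat in sequentially. \<exists>K. K \<ge> 2 \<and> V \<le> sqrt K \<and>
           ln (ln n) / ln n \<le> 8 / K \<and>
           n * (16 * pi * exp K / (sqrt K / V) ^ K) \<le> 1"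
proof -
  define c where "c = ln V"
  have "\<forall>\<^sub>F n :: nat in sequentially. ln (ln n) > 0"
    and "\<forall>\<^sub>F n :: nat in sequentially. 4 * ln n / ln (ln n) \<ge> 2"
    and "\<forall>\<^sub>F n :: nat in sequentially. 4 * ln n / ln (ln n) \<ge> V\<^sup>2"
    and "\<forall>\<^sub>F n :: nat in sequentially.
           1 + c - ln (4 * ln n / ln (ln n)) / 2 \<le> - (3 / 8) * ln (ln n)"
    and "\<forall>\<^sub>F n :: nat in sequentially. n * (16 * pi * exp (- (3 / 2) * ln n)) \<le> 1"
    by real_asymp+
  then show ?thesis
    using eventually_gt_at_top[of 2]
  proof eventually_elim
    case (elim n)
    define L \<kappa> K where "L = ln (real n)" and "\<kappa> = 4 * L / ln L" and "K = nat \<lceil>\<kappa>\<rceil>"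
    have L: "L > 0" "ln L > 0" using elim by (auto simp: L_def)
    have \<kappa>: "\<kappa> \<ge> 2" "\<kappa> \<ge> V\<^sup>2" using elim by (simp_all add: \<kappa>_def L_def)
    have K: "\<kappa> \<le> real K" "real K \<le> \<kappa> + 1" using \<kappa> unfolding K_def by linarith+
    show ?case
    proof (intro exI[of _ K] conjI)
      show "K \<ge> 2" using \<kappa> K by linarith
      show "V \<le> sqrt K" using \<kappa> K by (intro real_le_rsqrt) linarith
      have "real K \<le> 2 * \<kappa>" using \<kappa> K by linarith
      also have "\<dots> = 8 * L / ln L" by (simp add: \<kappa>_def)
      finally show "ln (ln n) / ln n \<le> 8 / K"
        using L \<kappa> K unfolding L_def[symmetric] by (simp add: field_simps)
      have "(sqrt K / V) ^ K = exp (K * ln (sqrt K / V))"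
        using assms \<kappa> K by (simp add: exp_of_nat_mult)
      also have "ln (sqrt K / V) = ln K / 2 - c"
        using assms \<kappa> K by (simp add: ln_div ln_sqrt c_def)
      finally have "exp K / (sqrt K / V) ^ K = exp (K * (1 + c - ln K / 2))"
        by (simp add: exp_diff[symmetric] algebra_simps)
      also have "K * (1 + c - ln K / 2) \<le> K * (- (3 / 8) * ln L)"
      proof (rule mult_left_mono)
        have "ln \<kappa> \<le> ln K" using \<kappa> K by (subst ln_le_cancel_iff) auto
        then show "1 + c - ln K / 2 \<le> - (3 / 8) * ln L"
          using elim(4) unfolding \<kappa>_def L_def by linarith
      qed simp
      also have "\<dots> \<le> \<kappa> * (- (3 / 8) * ln L)"
        using K L by (intro mult_right_mono_neg) auto
      also have "\<dots> = - (3 / 2) * ln n" using L by (simp add: \<kappa>_def L_def[symmetric])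
      finally have "exp K / (sqrt K / V) ^ K \<le> exp (- (3 / 2) * ln n)" by simp
      then have "n * (16 * pi * (exp K / (sqrt K / V) ^ K)) \<le> n * (16 * pi * exp (- (3 / 2) * ln n))"
        by (intro mult_left_mono) auto
      then show "n * (16 * pi * exp K / (sqrt K / V) ^ K) \<le> 1" using elim(5) by simp
    qed
  qed
qed

theorem theorem3:
  shows "\<exists>C'::real. C' > 0 \<and>
    (\<forall>V::real. V > 0 \<longrightarrow>
      (\<exists>r::nat \<Rightarrow> real. r \<longlonglongrightarrow> 0 \<and>
        (\<forall>(n::nat) (p::real) (x::nat \<Rightarrow> real).
           n \<ge> 2 \<longrightarrow> 1 \<le> p \<longrightarrow> is_design n x \<longrightarrow>
           ennreal (C' * V * (ln (ln (real n)) / ln (real n)) * (1 + r n))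
             \<le> minimax_risk std_gaussian n x V p)))"
proof (intro exI[of _ "1 / 128"] conjI allI impI)
  fix V :: real assume V: "V > 0"
  define good where "good = (\<lambda>n::nat. \<forall>p x. 1 \<le> p \<longrightarrow> is_design n x \<longrightarrow>
      ennreal (1 / 128 * V * (ln (ln (real n)) / ln (real n))) \<le> minimax_risk std_gaussian n x V p)"
  have "\<forall>\<^sub>F n in sequentially. good n"
    using eventually_node_count[OF V] eventually_ge_at_top[of 1]
  proof eventually_elim
    case (elim n)
    then obtain K :: nat where K: "K \<ge> 2" "V \<le> sqrt K" "ln (ln n) / ln n \<le> 8 / K"
      and small: "n * (16 * pi * exp K / (sqrt K / V) ^ K) \<le> 1" by blast
    \<comment> \<open>This choice balances \<open>exp (s\<^sup>2 * V\<^sup>2) = exp K\<close> against \<open>s ^ K\<close>.\<close>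
    define s where "s = sqrt K / V"
    have s: "s \<ge> 1" using K V by (simp add: s_def)
    define \<delta> where "\<delta> = 4 * (V * pi / (2 * K)) * exp ((s + s\<^sup>2) * V\<^sup>2 / 2) / s ^ K"
    have "s + s\<^sup>2 \<le> 2 * s\<^sup>2" using s self_le_power[of s 2] by simp
    then have "(s + s\<^sup>2) * V\<^sup>2 / 2 \<le> (2 * s\<^sup>2) * V\<^sup>2 / 2" by (intro divide_right_mono mult_right_mono) auto
    also have "\<dots> = K" using V by (simp add: s_def power_divide)
    finally have "\<delta> \<le> 4 * (V * pi / (2 * K)) * exp K / s ^ K"
      unfolding \<delta>_def using V s by (intro divide_right_mono mult_left_mono) auto
    then have "real n * \<delta> \<le> real n * (4 * (V * pi / (2 * K)) * exp K / s ^ K)"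
      by (intro mult_left_mono) auto
    also have "\<dots> = V / (8 * K) * (n * (16 * pi * exp K / s ^ K))" by simp
    also have "\<dots> \<le> V / (8 * K) * 1"
      using small V unfolding s_def by (intro mult_left_mono) auto
    finally have n\<delta>: "real n * \<delta> \<le> V / (8 * K)" by simp
    have "1 / 128 * V * (ln (ln (real n)) / ln (real n)) \<le> 1 / 128 * V * (8 / K)"
      using K V by (intro mult_left_mono) auto
    also have "\<dots> \<le> V / (4 * real (2 * K)) - real n * \<delta> / 2"
      using n\<delta> by simp
    finally have "1 / 128 * V * (ln (ln (real n)) / ln (real n)) \<le> V / (4 * real (2 * K)) - real n * \<delta> / 2" .
    then show ?case
      unfolding good_def
      using minimax_risk_ge[OF refl K(1) elim(2) V s] unfolding \<delta>_def
      by (fastforce intro: order_trans[OF ennreal_leI])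
  qed
  then have r: "\<forall>\<^sub>F n in sequentially. (if good n then 0 else - 1 :: real) = 0"
    by eventually_elim simp
  show "\<exists>r::nat \<Rightarrow> real. r \<longlonglongrightarrow> 0 \<and>
        (\<forall>(n::nat) (p::real) (x::nat \<Rightarrow> real).
           n \<ge> 2 \<longrightarrow> 1 \<le> p \<longrightarrow> is_design n x \<longrightarrow>
           ennreal (1 / 128 * V * (ln (ln (real n)) / ln (real n)) * (1 + r n))
             \<le> minimax_risk std_gaussian n x V p)"
    \<comment> \<open>For the finitely many remaining \<open>n\<close> the value \<open>- 1\<close> makes the lower bound zero.\<close>
  proof (intro exI[of _ "\<lambda>n. if good n then 0 else - 1"] conjI allI impI)
    show "(\<lambda>n. if good n then 0 else - 1 :: real) \<longlonglongrightarrow> 0"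
      by (rule tendsto_eventually[OF r])
  qed (auto simp: good_def)
qed simp

end
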